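(* Let $\mathcal{T}_h$ be a polygonal mesh of $\Omega$ with vertices $\{z_i\}_{i\in I_h}$, local patches $\Omega_{z_i}$ and gradient recovery operator $G_h$ (as defined in the context). For each $i\in I_h$: if $u$ is a quadratic polynomial on $\Omega_{z_i}$ (i.e. $u\in\mathbb{P}_2(\Omega_{z_i})$), then $$G_hu(z_i)=\nabla u(z_i).$$
   Context: $\Omega\subset\mathbb{R}^2$ is a bounded polygonal domain with Lipschitz boundary. $\mathbb{P}_m(\mathcal{D})$ denotes the polynomials of degree at most $m$ on $\mathcal{D}$. $\mathcal{T}_h$ is a partition of $\Omega$ into non-overlapping (closed) polygonal elements $E$ with non-self-intersecting polygonal boundaries; $h_E$ is the diameter of $E$ and $h=\max_{E}h_E$. Standing mesh assumptions: there is $\rho\in(0,1)$ such that (i) every element $E$ is star-shaped with respect to every point of a disk of radius $\rho h_E$; (ii) every edge $e$ of $E$ has length $|e|\ge\rho h_E$. $\mathcal{N}_h=\{z_i\}_{i\in I_h}$ is the set of all mesh vertices and $\mathcal{E}_h$ the set of all mesh edges. Local patches. For a vertex $z_i$, $\mathcal{L}(z_i,0)=\{z_i\}$; $\mathcal{L}(z_i,1)$ is the union of all $E\in\mathcal{T}_h$ with $z_i\in E$; for $n\ge2$, $\mathcal{L}(z_i,n)$ is the union of the elements in $\mathcal{L}(z_i,n-1)$ and of their neighbouring elements, i.e. those meeting $\mathcal{L}(z_i,n-1)$ along an edge in $\mathcal{E}_h$ (so it consists of the first $n$ layers of elements around $z_i$). The patch is $\Omega_{z_i}=\mathcal{L}(z_i,n_i)$,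 where $n_i$ is the smallest integer such that the patch satisfies the rank condition: the least-squares problem below has a unique solution $p_{z_i}$. Gradient recovery. Let $\{z_{i_j}\}$ be the set of all mesh vertices lying in $\Omega_{z_i}$. For a function $v$ with well-defined values at these vertices, let $p_{z_i}$ be the unique minimizer over $p\in\mathbb{P}_2(\Omega_{z_i})$ of $\sum_{j}|p(z_{i_j})-v(z_{i_j})|^2$, and set $G_hv(z_i)=\nabla p_{z_i}(z_i)\in\mathbb{R}^2$. *)

theory Defs
  imports "HOL-Analysis.Analysis"
begin

subsection \<open>Polynomials and gradients on the plane\<close>

definition polys :: "nat \<Rightarrow> (real^2 \<Rightarrow> real) set" where
  "polys m = {p. \<exists>c :: nat \<Rightarrow> nat \<Rightarrow> real.
      \<forall>x. p x = (\<Sum>i\<le>m. \<Sum>j\<le>m - i. c i j * (x$1)^i * (x$2)^j)}"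

text \<open>Functions on the plane whose restriction to \<open>D\<close> is a polynomial of degree at most \<open>m\<close>;
  nothing is required outside \<open>D\<close>.\<close>

definition polys_on :: "nat \<Rightarrow> (real^2) set \<Rightarrow> (real^2 \<Rightarrow> real) set" where
  "polys_on m D = {u. \<exists>p\<in>polys m. \<forall>x\<in>D. u x = p x}"

text \<open>The gradient of a function regarded as a function on \<open>D\<close> only. The point \<open>x\<close> may lie on the
  boundary of \<open>D\<close>, which is why the derivative is taken within \<open>D\<close>.\<close>

definition grad_within :: "(real^2) set \<Rightarrow> (real^2 \<Rightarrow> real) \<Rightarrow> real^2 \<Rightarrow> real^2" where
  "grad_within D f x = (THE g. (f has_derivative (\<lambda>h. g \<bullet> h)) (at x within D))"

abbreviation grad :: "(real^2 \<Rightarrow> real) \<Rightarrow> real^2 \<Rightarrow> real^2" where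
  "grad \<equiv> grad_within UNIV"


subsection \<open>Polygonal domains\<close>

text \<open>Near each boundary point, after a rigid motion, the set is the region strictly above the graph
  of a Lipschitz function.\<close>

definition lipschitz_boundary :: "(real^2) set \<Rightarrow> bool" where
  "lipschitz_boundary \<Omega> \<longleftrightarrow>
     (\<forall>x\<in>frontier \<Omega>. \<exists>r>0. \<exists>a b. \<exists>L. \<exists>\<gamma> :: real \<Rightarrow> real.
        norm a = 1 \<and> norm b = 1 \<and> a \<bullet> b = 0 \<and> L-lipschitz_on UNIV \<gamma> \<and>
        \<Omega> \<inter> ball x r = {y \<in> ball x r. \<gamma> ((y - x) \<bullet> a) < (y - x) \<bullet> b})"

definition polygonal_domain :: "(real^2) set \<Rightarrow> bool" where
  "polygonal_domain \<Omega> \<longleftrightarrow> open \<Omega> \<and> connected \<Omega> \<and> \<Omega> \<noteq> {} \<and>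
     (\<exists>S. finite S \<and> frontier \<Omega> = (\<Union>(a, b)\<in>S. closed_segment a b))"


subsection \<open>Polygonal meshes\<close>

text \<open>A polygon is given by the list of its vertices in cyclic order. Interior angles equal to
  \<open>\<pi>\<close> are allowed, so a hanging node of a mesh can be a vertex of every element that contains it.\<close>

fun polygonal_path :: "(real^2) list \<Rightarrow> real \<Rightarrow> real^2" where
  "polygonal_path [] = linepath 0 0"
| "polygonal_path [a] = linepath a a"
| "polygonal_path [a, b] = linepath a b"
| "polygonal_path (a # b # c # xs) = linepath a b +++ polygonal_path (b # c # xs)"

definition polygon_boundary :: "(real^2) list \<Rightarrow> real \<Rightarrow> real^2" where
  "polygon_boundary vs = polygonal_path (vs @ [hd vs])"

definition simple_polygon :: "(real^2) list \<Rightarrow> bool" where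
  "simple_polygon vs \<longleftrightarrow> 3 \<le> length vs \<and> simple_path (polygon_boundary vs)"

definition region :: "(real^2) list \<Rightarrow> (real^2) set" where
  "region vs = path_image (polygon_boundary vs) \<union> inside (path_image (polygon_boundary vs))"

definition edge_pairs :: "(real^2) list \<Rightarrow> ((real^2) \<times> (real^2)) set" where
  "edge_pairs vs = set (zip vs (rotate1 vs))"

definition mesh_vertices :: "(real^2) list set \<Rightarrow> (real^2) set" where
  "mesh_vertices T = (\<Union>vs\<in>T. set vs)"

definition mesh_edges :: "(real^2) list set \<Rightarrow> (real^2) set set" where
  "mesh_edges T = (\<Union>vs\<in>T. (\<lambda>(a, b). closed_segment a b) ` edge_pairs vs)"

definition polygonal_mesh :: "(real^2) set \<Rightarrow> (real^2) list set \<Rightarrow> bool" where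
  "polygonal_mesh \<Omega> T \<longleftrightarrow> finite T \<and> (\<forall>vs\<in>T. simple_polygon vs) \<and>
     (\<Union>vs\<in>T. region vs) = closure \<Omega> \<and>
     (\<forall>vs\<in>T. \<forall>ws\<in>T. vs \<noteq> ws \<longrightarrow> interior (region vs) \<inter> interior (region ws) = {})"

definition star_shaped_wrt :: "(real^2) set \<Rightarrow> real^2 \<Rightarrow> bool" where
  "star_shaped_wrt S a \<longleftrightarrow> a \<in> S \<and> (\<forall>x\<in>S. closed_segment a x \<subseteq> S)"

definition shape_regular :: "real \<Rightarrow> (real^2) list set \<Rightarrow> bool" where
  "shape_regular \<rho> T \<longleftrightarrow>
     (\<forall>vs\<in>T.
        (\<exists>c. \<forall>a\<in>cball c (\<rho> * diameter (region vs)). star_shaped_wrt (region vs) a) \<and>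
        (\<forall>(a, b)\<in>edge_pairs vs. \<rho> * diameter (region vs) \<le> dist a b))"


subsection \<open>Local patches and gradient recovery\<close>

text \<open>The elements forming the first \<open>n\<close> layers around \<open>z\<close>. The patch with \<open>n = 0\<close> is the
  point \<open>z\<close> itself and contains no element.\<close>

fun layer_elements :: "(real^2) list set \<Rightarrow> real^2 \<Rightarrow> nat \<Rightarrow> (real^2) list set" where
  "layer_elements T z 0 = {}"
| "layer_elements T z (Suc 0) = {vs\<in>T. z \<in> region vs}"
| "layer_elements T z (Suc (Suc n)) =
     layer_elements T z (Suc n) \<union>
     {vs\<in>T. \<exists>e\<in>mesh_edges T. e \<subseteq> region vs \<inter> (\<Union>ws\<in>layer_elements T z (Suc n). region ws)}"

definition layers :: "(real^2) list set \<Rightarrow> real^2 \<Rightarrow> nat \<Rightarrow> (real^2) set" where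
  "layers T z n = (if n = 0 then {z} else \<Union>vs\<in>layer_elements T z n. region vs)"

text \<open>Least-squares fitting on a set \<open>D\<close>. The minimisation runs over polynomials on the whole plane
  and not over their restrictions to \<open>D\<close>; the two agree once \<open>D\<close> contains an element, but for the
  degenerate patch \<open>D = {z}\<close> restrictions would make the fit unique and leave its gradient
  meaningless.\<close>

definition is_ls_fit ::
    "(real^2) list set \<Rightarrow> (real^2) set \<Rightarrow> (real^2 \<Rightarrow> real) \<Rightarrow> (real^2 \<Rightarrow> real) \<Rightarrow> bool" where
  "is_ls_fit T D v =
     is_arg_min (\<lambda>p. \<Sum>w\<in>mesh_vertices T \<inter> D. \<bar>p w - v w\<bar>\<^sup>2) (\<lambda>p. p \<in> polys 2)"

definition rank_condition :: "(real^2) list set \<Rightarrow> (real^2) set \<Rightarrow> bool" where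
  "rank_condition T D \<longleftrightarrow> (\<forall>v. \<exists>!p. is_ls_fit T D v p)"

definition patch :: "(real^2) list set \<Rightarrow> real^2 \<Rightarrow> (real^2) set" where
  "patch T z = layers T z (LEAST n. rank_condition T (layers T z n))"

definition recovered_poly ::
    "(real^2) list set \<Rightarrow> (real^2 \<Rightarrow> real) \<Rightarrow> real^2 \<Rightarrow> (real^2 \<Rightarrow> real)" where
  "recovered_poly T v z = (THE p. is_ls_fit T (patch T z) v p)"

definition recovered_gradient :: "(real^2) list set \<Rightarrow> (real^2 \<Rightarrow> real) \<Rightarrow> real^2 \<Rightarrow> real^2" where
  "recovered_gradient T v z = grad (recovered_poly T v z) z"

end

theory Submission
  imports Defs
begin

text \<open>On the patch \<open>u\<close> agrees with a quadratic polynomial \<open>p\<close>, which thus has residual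
  zero at all vertices of the patch, so it is a least-squares fit, and by the rank condition the only
  one (\<open>recovered_poly_reproduces\<close>). The recovered gradient is therefore \<open>\<nabla>p(z)\<close>.

  What remains is that \<open>u\<close>, known only on the patch, has there a well-determined gradient at \<open>z\<close>,
  although \<open>z\<close> may lie on the boundary of the patch. The rank condition excludes the patch \<open>{z}\<close>,
  because a linear function vanishing at \<open>z\<close> cannot be told from zero there; so the patch contains
  an element with vertex \<open>z\<close>. This element is star-shaped with respect to a nondegenerate
  disk, so it contains every segment from \<open>z\<close> to that disk (\<open>element_contains_cone\<close>). The directions
  of these segments fill a disk, and a linear functional is determined by its values on it
  (\<open>grad_within_cone_eqI\<close>). Hence \<open>u\<close> and \<open>p\<close> have the same gradient at \<open>z\<close>.\<close>

text \<open>Restricting to a segment turns the derivative within \<open>D\<close> into a one-sided derivative on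
  \<open>[0, 1]\<close>, which is unique.\<close>

lemma derivative_within_unique_on_segment:
  fixes f :: "'a::real_normed_vector \<Rightarrow> real"
  assumes f: "(f has_derivative F) (at z within D)" and g: "(f has_derivative G) (at z within D)"
    and seg: "closed_segment z a \<subseteq> D"
  shows "F (a - z) = G (a - z)"
proof -
  define \<gamma> where "\<gamma> t = z + t *\<^sub>R (a - z)" for t :: real
  have \<gamma>: "(\<gamma> has_derivative (\<lambda>t. t *\<^sub>R (a - z))) (at 0 within {0..1})"
    unfolding \<gamma>_def by (auto intro!: derivative_eq_intros)
  have im: "\<gamma> ` {0..1} \<subseteq> D"
    using seg by (auto simp: \<gamma>_def closed_segment_image_interval algebra_simps)
  have *: "((f \<circ> \<gamma>) has_vector_derivative H (a - z)) (at 0 within {0..1})"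
    if "(f has_derivative H) (at z within D)" for H
  proof -
    have "(f has_derivative H) (at (\<gamma> 0) within \<gamma> ` {0..1})"
      using has_derivative_subset[OF that im] by (simp add: \<gamma>_def)
    from diff_chain_within[OF \<gamma> this] show ?thesis
      using linear_scale[OF has_derivative_linear[OF that]]
      by (simp add: has_vector_derivative_def o_def)
  qed
  show ?thesis
    using vector_derivative_unique_within_closed_interval[of 0 1 0] *[OF f] *[OF g]
    by (simp add: cbox_interval)
qed

text \<open>The conclusion identifies the value selected by the description operator in
  \<open>grad_within\<close>, so it needs uniqueness: two candidates agree on all directions
  towards a disk, and the difference of two such directions can be any short vector.\<close>

lemma grad_within_cone_eqI:
  assumes f: "(f has_derivative (\<lambda>h. g \<bullet> h)) (at z within D)"
    and "0 < r" and cone: "\<And>a. a \<in> cball c r \<Longrightarrow> closed_segment z a \<subseteq> D"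
  shows "grad_within D f z = g"
  unfolding grad_within_def
proof (rule the_equality)
  show "(f has_derivative (\<lambda>h. g \<bullet> h)) (at z within D)"
    by (fact f)
next
  fix g' assume g': "(f has_derivative (\<lambda>h. g' \<bullet> h)) (at z within D)"
  define w where "w = g' - g"
  have *: "w \<bullet> (a - z) = 0" if "a \<in> cball c r" for a
    using derivative_within_unique_on_segment[OF g' f cone[OF that]]
    by (simp add: w_def inner_diff_left)
  have "w = 0"
  proof (rule ccontr)
    assume "w \<noteq> 0"
    \<comment> \<open>Moving from the centre by length \<open>r\<close> along \<open>w\<close> changes the functional \<open>w \<bullet> _\<close> by \<open>r * norm w\<close>.\<close>
    define a where "a = c + (r / norm w) *\<^sub>R w"
    have "a \<in> cball c r" "c \<in> cball c r"
      using \<open>w \<noteq> 0\<close> \<open>0 < r\<close> by (auto simp: a_def dist_norm)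
    then have "w \<bullet> (a - c) = 0"
      using *[of a] *[of c] by (simp add: inner_diff_right)
    then show False
      using \<open>w \<noteq> 0\<close> \<open>0 < r\<close> by (simp add: a_def)
  qed
  then show "g' = g"
    by (simp add: w_def)
qed

lemma polys_has_gradient:
  assumes "p \<in> polys m"
  obtains g where "(p has_derivative (\<lambda>h. g \<bullet> h)) (at z)"
proof -
  obtain c where "\<forall>x. p x = (\<Sum>i\<le>m. \<Sum>j\<le>m - i. c i j * (x$1)^i * (x$2)^j)"
    using assms by (auto simp: polys_def)
  then have p: "p = (\<lambda>x. \<Sum>i\<le>m. \<Sum>j\<le>m - i. c i j * (x$1)^i * (x$2)^j)"
    by auto
  have nth: "(\<lambda>x::real^2. x $ k) differentiable (at z)" for k
    by (simp add: bounded_linear_imp_differentiable bounded_linear_vec_nth)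
  have "p differentiable (at z)"
    unfolding p by (intro differentiable_sum differentiable_mult differentiable_power
        differentiable_const nth finite_atMost ballI)
  then obtain F where F: "(p has_derivative F) (at z)"
    by (auto simp: differentiable_def)
  then have "F h = adjoint F 1 \<bullet> h" for h
    using adjoint_works[OF has_derivative_linear[OF F], of h 1] by (simp add: inner_commute)
  then have "F = (\<lambda>h. adjoint F 1 \<bullet> h)"
    by auto
  then show ?thesis
    using F that by metis
qed

lemma pathstart_polygonal_path: "pathstart (polygonal_path (a # vs)) = a"
  by (cases "a # vs" rule: polygonal_path.cases) auto

lemma vertices_subset_polygonal_path: "set vs \<subseteq> path_image (polygonal_path vs)"
proof (induction vs rule: polygonal_path.induct)
  case (4 a b c xs)
  have "path_image (polygonal_path (a # b # c # xs)) =
      closed_segment a b \<union> path_image (polygonal_path (b # c # xs))"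
    by (simp add: path_image_join pathstart_polygonal_path)
  then show ?case
    using 4 by auto
qed auto

lemma vertices_subset_region: "set vs \<subseteq> region vs"
  using vertices_subset_polygonal_path[of "vs @ [hd vs]"]
  by (auto simp: region_def polygon_boundary_def)

lemma diameter_region_pos:
  assumes "simple_polygon vs"
  shows "0 < diameter (region vs)"
proof -
  let ?P = "polygon_boundary vs"
  have simple: "simple_path ?P"
    using assms by (simp add: simple_polygon_def)
  then have "bounded (path_image ?P)"
    by (simp add: bounded_simple_path_image)
  then have "bounded (region vs)"
    by (simp add: region_def bounded_inside)
  moreover have "?P (1/3) \<in> region vs" "?P (1/2) \<in> region vs"
    by (auto simp: region_def path_image_def)
  ultimately have "dist (?P (1/3)) (?P (1/2)) \<le> diameter (region vs)"
    by (rule diameter_bounded_bound)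
  moreover have "?P (1/3) \<noteq> ?P (1/2)"
  proof
    assume "?P (1/3) = ?P (1/2)"
    moreover have "loop_free ?P"
      using simple by (simp add: simple_path_def)
    ultimately have "(1/3::real) = 1/2"
      using loop_free_def[of ?P] by fastforce
    then show False
      by simp
  qed
  ultimately show ?thesis
    using zero_less_dist_iff[of "?P (1/3)" "?P (1/2)"] by linarith
qed

text \<open>Star-shapedness is used backwards here: the star centres fill a disk, and the
  point \<open>z\<close> of the element sees all of them.\<close>

lemma element_contains_cone:
  assumes "simple_polygon vs" "vs \<in> T" "0 < \<rho>" "shape_regular \<rho> T" "z \<in> region vs"
  obtains c r where "0 < r" "\<And>a. a \<in> cball c r \<Longrightarrow> closed_segment z a \<subseteq> region vs"
proof -
  obtain c where c: "\<forall>a\<in>cball c (\<rho> * diameter (region vs)). star_shaped_wrt (region vs) a"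
    using assms by (auto simp: shape_regular_def)
  show ?thesis
  proof
    show "0 < \<rho> * diameter (region vs)"
      using diameter_region_pos[OF assms(1)] \<open>0 < \<rho>\<close> by simp
    show "closed_segment z a \<subseteq> region vs" if "a \<in> cball c (\<rho> * diameter (region vs))" for a
      using c that assms(5) by (metis closed_segment_commute star_shaped_wrt_def)
  qed
qed

lemma first_layer_subset_layer_elements:
  "{vs\<in>T. z \<in> region vs} \<subseteq> layer_elements T z (Suc n)"
  by (induction n) auto

text \<open>For data vanishing at \<open>z\<close>, both \<open>0\<close> and \<open>x\<^sub>1 - z\<^sub>1\<close> interpolate.\<close>

lemma not_rank_condition_singleton: "\<not> rank_condition T {z}"
proof
  assume "rank_condition T {z}"
  then have uniq: "\<exists>!p. is_ls_fit T {z} (\<lambda>_. 0) p"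
    by (simp add: rank_condition_def)
  have fit: "is_ls_fit T {z} (\<lambda>_. 0) p" if "p \<in> polys 2" "p z = 0" for p
  proof -
    have "(\<Sum>w\<in>mesh_vertices T \<inter> {z}. \<bar>p w - 0\<bar>\<^sup>2) = 0"
      using that by (intro sum.neutral) auto
    then show ?thesis
      using that(1) by (auto simp: is_ls_fit_def is_arg_min_def not_less intro!: sum_nonneg)
  qed
  define q where "q = (\<lambda>x::real^2. x$1 - z$1)"
  have "(\<lambda>_. 0) \<in> polys 2"
    by (auto simp: polys_def intro!: exI[of _ "\<lambda>_ _. 0"])
  moreover have "q \<in> polys 2"
    unfolding polys_def q_def
    by (auto simp: numeral_2_eq_2
        intro!: exI[of _ "\<lambda>i j. if i = 1 \<and> j = 0 then 1 else if i = 0 \<and> j = 0 then - z$1 else 0"])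
  ultimately have "q = (\<lambda>_. 0)"
    using uniq fit[of q] fit[of "\<lambda>_. 0"] by (auto simp: q_def)
  then have "q (z + axis 1 1) = 0"
    by simp
  then show False
    by (simp add: q_def axis_def)
qed

lemma patch_contains_first_layer:
  assumes ex: "\<exists>n. rank_condition T (layers T z n)" and "vs \<in> T" "z \<in> region vs"
  shows "region vs \<subseteq> patch T z"
proof -
  let ?n = "LEAST n. rank_condition T (layers T z n)"
  have "?n \<noteq> 0"
  proof
    assume "?n = 0"
    then have "rank_condition T (layers T z 0)"
      using LeastI_ex[OF ex] by simp
    then show False
      using not_rank_condition_singleton[of T z] by (simp add: layers_def)
  qed
  then obtain k where "?n = Suc k"
    by (cases ?n) auto
  moreover have "vs \<in> layer_elements T z (Suc k)"
    using first_layer_subset_layer_elements[of T z k] assms by blast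
  ultimately show ?thesis
    by (auto simp: patch_def layers_def simp del: layer_elements.simps)
qed

lemma recovered_poly_reproduces:
  assumes ex: "\<exists>n. rank_condition T (layers T z n)"
    and p: "p \<in> polys 2" and eq: "\<And>x. x \<in> patch T z \<Longrightarrow> u x = p x"
  shows "recovered_poly T u z = p"
proof -
  have "(\<Sum>w\<in>mesh_vertices T \<inter> patch T z. \<bar>p w - u w\<bar>\<^sup>2) = 0"
    using eq by (intro sum.neutral) auto
  then have "is_ls_fit T (patch T z) u p"
    using p by (auto simp: is_ls_fit_def is_arg_min_def not_less intro!: sum_nonneg)
  moreover have "\<exists>!p. is_ls_fit T (patch T z) u p"
    using LeastI_ex[OF ex] by (simp add: patch_def rank_condition_def)
  ultimately show ?thesis
    by (simp add: recovered_poly_def the1_equality)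
qed

theorem theorem4p5:
  fixes \<Omega> :: "(real^2) set" and T :: "(real^2) list set" and \<rho> :: real
    and z :: "real^2" and u :: "real^2 \<Rightarrow> real"
  assumes "bounded \<Omega>" and "polygonal_domain \<Omega>" and "lipschitz_boundary \<Omega>"
    and "polygonal_mesh \<Omega> T"
    and "0 < \<rho>" and "\<rho> < 1" and "shape_regular \<rho> T"
    and "z \<in> mesh_vertices T"
    and "\<exists>n. rank_condition T (layers T z n)"
    and "u \<in> polys_on 2 (patch T z)"
  shows "recovered_gradient T u z = grad_within (patch T z) u z"
proof -
  obtain vs where vs: "vs \<in> T" "z \<in> region vs"
    using assms(8) vertices_subset_region by (auto simp: mesh_vertices_def)
  have "simple_polygon vs"
    using assms(4) vs by (simp add: polygonal_mesh_def)
  then obtain c r where r: "0 < r"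
    and "\<And>a. a \<in> cball c r \<Longrightarrow> closed_segment z a \<subseteq> region vs"
    using element_contains_cone[OF _ vs(1) assms(5,7) vs(2)] by metis
  then have cone: "\<And>a. a \<in> cball c r \<Longrightarrow> closed_segment z a \<subseteq> patch T z"
    using patch_contains_first_layer[OF assms(9) vs] by blast
  have z: "z \<in> patch T z"
    using patch_contains_first_layer[OF assms(9) vs] vs by blast
  obtain p where p: "p \<in> polys 2" and eq: "\<And>x. x \<in> patch T z \<Longrightarrow> u x = p x"
    using assms(10) by (auto simp: polys_on_def)
  obtain g where g: "(p has_derivative (\<lambda>h. g \<bullet> h)) (at z)"
    using polys_has_gradient[OF p] .
  have "(u has_derivative (\<lambda>h. g \<bullet> h)) (at z within patch T z)"
    using has_derivative_transform[OF z eq has_derivative_at_withinI[OF g]] .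
  then have "grad_within (patch T z) u z = g"
    using r cone by (rule grad_within_cone_eqI)
  moreover have "grad p z = g"
    using g r by (rule grad_within_cone_eqI) simp
  ultimately show ?thesis
    by (simp add: recovered_gradient_def recovered_poly_reproduces[OF assms(9) p eq])
qed

end
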